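(* Let $\mathcal{P}$ be a finite-dimensional Poisson algebra over an arbitrary field $\mathbb{F}$, with solvable radical $R$ and nilradical $N(\mathcal{P})$. Then $R_A^2\subseteq N(\mathcal{P})$, where $R_A^2=R\cdot R$.
   Context: A Poisson algebra $(\mathcal{P},\cdot,[\cdot,\cdot])$ over $\mathbb{F}$ is a vector space with two bilinear products such that $(\mathcal{P},\cdot)$ is a commutative associative algebra (not necessarily unital), $(\mathcal{P},[\cdot,\cdot])$ is a Lie algebra, and $[x\cdot y,z]=[x,z]\cdot y+x\cdot[y,z]$ for all $x,y,z$. For subspaces $X,Y$, $X\cdot Y$ and $[X,Y]$ denote the linear spans of all products. An ideal is a subspace $I$ with $I\cdot\mathcal{P}+[I,\mathcal{P}]\subseteq I$. A Poisson algebra $A$ is solvable if $A^{(m)}=0$ for some $m$, where $A^{(0)}=A$ and $A^{(n+1)}=A^{(n)}\cdot A^{(n)}+[A^{(n)},A^{(n)}]$; it is nilpotent if $A^m=0$ for some $m$, where $A^1=A$ and $A^{n+1}=\sum_{i=1}^{n}(A^i\cdot A^{n+1-i}+[A^i,A^{n+1-i}])$. The (solvable) radical $R=R(\mathcal{P})$ is the largest solvable ideal of $\mathcal{P}$, and the nilradical $N(\mathcal{P})$ is the largest nilpotent ideal of $\mathcal{P}$ (equivalently, the largest ideal $I$ that is nilpotent both as an associative algebra $(I,\cdot)$ and as a Lie algebra $(I,[\cdot,\cdot])$). *)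

theory Defs
  imports Complex_Main "HOL-Library.Set_Algebras"
begin

text \<open>
  The carrier of a Poisson algebra over the field \<open>'k\<close> is the whole type \<open>'a\<close>.  The associative
  product is not assumed to be unital, and the bracket is alternating, so that the definition is
  the correct one in every characteristic.
\<close>

locale poisson_algebra = vector_space scale
  for scale :: "'k::field \<Rightarrow> 'a::ab_group_add \<Rightarrow> 'a" +
  fixes mult :: "'a \<Rightarrow> 'a \<Rightarrow> 'a"
    and brk :: "'a \<Rightarrow> 'a \<Rightarrow> 'a"
  assumes mult_linear_left: "Vector_Spaces.linear scale scale (\<lambda>x. mult x y)"
    and mult_linear_right: "Vector_Spaces.linear scale scale (\<lambda>y. mult x y)"
    and mult_assoc: "mult (mult x y) z = mult x (mult y z)"
    and mult_commute: "mult x y = mult y x"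
    and brk_linear_left: "Vector_Spaces.linear scale scale (\<lambda>x. brk x y)"
    and brk_linear_right: "Vector_Spaces.linear scale scale (\<lambda>y. brk x y)"
    and brk_self: "brk x x = 0"
    and jacobi: "brk x (brk y z) + brk y (brk z x) + brk z (brk x y) = 0"
    and leibniz: "brk (mult x y) z = mult (brk x z) y + mult x (brk y z)"
begin

definition mult_space :: "'a set \<Rightarrow> 'a set \<Rightarrow> 'a set" where
  "mult_space X Y = span {mult x y | x y. x \<in> X \<and> y \<in> Y}"

definition brk_space :: "'a set \<Rightarrow> 'a set \<Rightarrow> 'a set" where
  "brk_space X Y = span {brk x y | x y. x \<in> X \<and> y \<in> Y}"

text \<open>
  Below, \<open>+\<close> and \<open>\<Sum>\<close> on sets are the elementwise operations of \<^theory>\<open>HOL-Library.Set_Algebras\<close>,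
  that is, sums of subspaces.
\<close>

definition ideal :: "'a set \<Rightarrow> bool" where
  "ideal I \<longleftrightarrow> subspace I \<and> mult_space I UNIV + brk_space I UNIV \<subseteq> I"

fun derived_series :: "'a set \<Rightarrow> nat \<Rightarrow> 'a set" where
  "derived_series A 0 = A"
| "derived_series A (Suc n) =
     mult_space (derived_series A n) (derived_series A n) +
     brk_space (derived_series A n) (derived_series A n)"

definition solvable :: "'a set \<Rightarrow> bool" where
  "solvable A \<longleftrightarrow> (\<exists>m. derived_series A m = {0})"

text \<open>
  \<open>poisson_power A n\<close> is the power \<open>A^n\<close> of the lower series, indexed from \<open>n = 1\<close>; the value at \<open>0\<close> is a dummy.
\<close>

fun poisson_power :: "'a set \<Rightarrow> nat \<Rightarrow> 'a set" where
  "poisson_power A 0 = A"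
| "poisson_power A (Suc 0) = A"
| "poisson_power A (Suc (Suc n)) =
     (\<Sum>i = 1..Suc n.
        mult_space (poisson_power A i) (poisson_power A (Suc (Suc n) - i)) +
        brk_space (poisson_power A i) (poisson_power A (Suc (Suc n) - i)))"

definition nilpotent :: "'a set \<Rightarrow> bool" where
  "nilpotent A \<longleftrightarrow> (\<exists>m\<ge>1. poisson_power A m = {0})"

text \<open>
  \<open>GREATEST\<close> is taken with respect to inclusion: the unique ideal of the given kind that contains
  all the others.
\<close>

definition radical :: "'a set" where
  "radical = (GREATEST I. ideal I \<and> solvable I)"

definition nilradical :: "'a set" where
  "nilradical = (GREATEST I. ideal I \<and> nilpotent I)"

end

end

theory Submission
  imports Defs
begin

text \<open>
  Write \<open>R\<^sup>k\<close> for the associative powers of the radical \<open>R\<close>.  Two observations prove the result.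

  The bracket is a biderivation, so expanding \<open>[x\<^sub>1 \<cdots> x\<^sub>a, y\<^sub>1 \<cdots> y\<^sub>b]\<close> by the Leibniz rule gives a sum of
  products of \<open>a + b - 1\<close> elements of \<open>R\<close>: all the \<open>x\<close>'s and \<open>y\<close>'s but two, and one bracket of those two.
  Hence \<open>[R\<^sup>a, R\<^sup>b] \<subseteq> R\<^bsup>a+b-1\<^esup>\<close>.  If the ideal \<open>R \<cdot> R = R\<^sup>2\<close> is given degree 1 and \<open>R\<^bsup>n+1\<^esup>\<close> degree \<open>n\<close>,
  both products respect degrees, and the \<open>n\<close>-th Poisson power of \<open>R\<^sup>2\<close> lies in \<open>R\<^bsup>n+1\<^esup>\<close>
  (\<open>assoc_power_filtration\<close>).

  On the other hand \<open>R\<^sup>k = 0\<close> for large \<open>k\<close>: a product of \<open>2\<^sup>n\<close> factors is a product of two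
  products of \<open>2\<^bsup>n-1\<^esup>\<close> factors, so \<open>R\<close> to the power \<open>2\<^sup>n\<close> lies in the \<open>n\<close>-th derived algebra
  (\<open>assoc_power_in_derived_series\<close>).  Thus \<open>R \<cdot> R\<close> is a nilpotent ideal.

  It remains to know that the radical and the nilradical are what their names say, that is, that
  there are a largest solvable and a largest nilpotent ideal.  In finite dimension this amounts to
  the statement that the sum of two such ideals is again such (\<open>solvable_ideal_sum\<close> and
  \<open>nilpotent_ideal_sum\<close>).  All nilpotency arguments go through filtrations: an ideal is nilpotent as
  soon as it sits in degree 1 of a filtration that respects both products and reaches zero.
\<close>

section \<open>Subspaces, products and ideals\<close>

context poisson_algebra
begin

lemma bilinear_on_spans:
  assumes left: "\<And>y. Vector_Spaces.linear scale scale (\<lambda>x. f x y)"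
    and right: "\<And>x. Vector_Spaces.linear scale scale (\<lambda>y. f x y)"
    and S: "subspace S"
    and gen: "\<And>x y. x \<in> X \<Longrightarrow> y \<in> Y \<Longrightarrow> f x y \<in> S"
    and x: "x \<in> span X" and y: "y \<in> span Y"
  shows "f x y \<in> S"
proof -
  have vimage: "subspace {z. g z \<in> S}" if "Vector_Spaces.linear scale scale g" for g
  proof -
    interpret g: Vector_Spaces.linear scale scale g by (rule that)
    show ?thesis
      using S by (simp add: subspace_def g.zero g.add g.scale)
  qed
  have "f x' y \<in> S" if "x' \<in> X" for x'
    using span_induct[OF y vimage[OF right]] gen[OF that] by auto
  then show ?thesis
    using span_induct[OF x vimage[OF left]] by auto
qed

lemma
  assumes "Vector_Spaces.linear scale scale f"
  shows linear_map_0: "f 0 = 0" and linear_map_add: "f (x + y) = f x + f y"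
    and linear_map_neg: "f (- x) = - f x" and linear_map_scale: "f (scale c x) = scale c (f x)"
proof -
  interpret f: Vector_Spaces.linear scale scale f by (rule assms)
  show "f 0 = 0" "f (x + y) = f x + f y" "f (- x) = - f x" "f (scale c x) = scale c (f x)"
    by (rule f.zero f.add f.neg f.scale)+
qed

lemmas mult_linear_simps =
  mult_linear_left[THEN linear_map_0] mult_linear_right[THEN linear_map_0]
  mult_linear_left[THEN linear_map_add] mult_linear_right[THEN linear_map_add]
  mult_linear_left[THEN linear_map_neg] mult_linear_right[THEN linear_map_neg]
  mult_linear_left[THEN linear_map_scale] mult_linear_right[THEN linear_map_scale]

lemmas brk_linear_simps =
  brk_linear_left[THEN linear_map_0] brk_linear_right[THEN linear_map_0]
  brk_linear_left[THEN linear_map_add] brk_linear_right[THEN linear_map_add]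
  brk_linear_left[THEN linear_map_neg] brk_linear_right[THEN linear_map_neg]
  brk_linear_left[THEN linear_map_scale] brk_linear_right[THEN linear_map_scale]

lemma brk_antisym: "brk x y = - brk y x"
proof -
  have "brk x y + brk y x = brk (x + y) (x + y)"
    unfolding brk_linear_simps by (simp add: brk_self)
  then show ?thesis
    by (simp only: brk_self eq_neg_iff_add_eq_0)
qed

lemma leibniz_right: "brk z (mult x y) = mult (brk z x) y + mult x (brk z y)"
proof -
  have "brk z (mult x y) = - (mult (brk x z) y + mult x (brk y z))"
    by (subst brk_antisym) (simp only: leibniz)
  also have "\<dots> = mult (- brk x z) y + mult x (- brk y z)"
    by (simp add: mult_linear_simps)
  also have "\<dots> = mult (brk z x) y + mult x (brk z y)"
    by (simp only: brk_antisym[symmetric])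
  finally show ?thesis .
qed

lemma jacobi_left: "brk (brk x y) z = brk (brk x z) y + brk x (brk y z)"
proof -
  have "brk x (brk y z) = - brk y (brk z x) + - brk z (brk x y)"
    using jacobi[of x y z] by (metis add.assoc add.commute eq_neg_iff_add_eq_0 minus_add_distrib)
  also have "- brk y (brk z x) = - brk (brk x z) y"
    by (metis brk_antisym brk_linear_simps(6))
  also have "- brk z (brk x y) = brk (brk x y) z"
    by (rule brk_antisym[symmetric])
  finally show ?thesis by simp
qed

lemma subspace_set_plus: "subspace X \<Longrightarrow> subspace Y \<Longrightarrow> subspace (X + Y)"
  using subspace_sums[of X Y] by (simp add: set_plus_def) (smt (verit) Collect_cong)

lemma set_plus_upper:
  assumes "subspace X" "subspace Y"
  shows "X \<subseteq> X + Y" "Y \<subseteq> X + Y"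
  using subspace_0[OF assms(1)] subspace_0[OF assms(2)]
  by (force simp: set_plus_def)+

lemma set_plus_least:
  assumes "subspace S" "X \<subseteq> S" "Y \<subseteq> S"
  shows "X + Y \<subseteq> S"
  using assms subspace_add[OF assms(1)] by (auto simp: set_plus_def)

lemma subspace_set_sum:
  assumes "\<And>i. i \<in> K \<Longrightarrow> subspace (X i)"
  shows "subspace (\<Sum>i\<in>K. X i)"
  using assms
proof (induction K rule: infinite_finite_induct)
  case (insert k K)
  then show ?case by (simp add: subspace_set_plus)
qed (simp_all add: set_zero subspace_single_0)

lemma set_sum_upper:
  assumes "finite K" "\<And>i. i \<in> K \<Longrightarrow> subspace (X i)" "k \<in> K"
  shows "X k \<subseteq> (\<Sum>i\<in>K. X i)"
proof -
  have "(\<Sum>i\<in>K. X i) = X k + (\<Sum>i\<in>K - {k}. X i)"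
    using assms by (simp add: sum.remove)
  then show ?thesis
    using set_plus_upper(1)[of "X k"] subspace_set_sum[of "K - {k}" X] assms by auto
qed

lemma set_sum_least:
  assumes "subspace S" "\<And>i. i \<in> K \<Longrightarrow> X i \<subseteq> S"
  shows "(\<Sum>i\<in>K. X i) \<subseteq> S"
  using assms(2)
proof (induction K rule: infinite_finite_induct)
  case (insert k K)
  then show ?case by (simp add: set_plus_least[OF assms(1)])
qed (simp_all add: set_zero subspace_0[OF assms(1)])

lemma subspace_mult_space: "subspace (mult_space X Y)"
  by (simp add: mult_space_def)

lemma subspace_brk_space: "subspace (brk_space X Y)"
  by (simp add: brk_space_def)

lemma mult_in_mult_space: "x \<in> X \<Longrightarrow> y \<in> Y \<Longrightarrow> mult x y \<in> mult_space X Y"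
  unfolding mult_space_def by (blast intro: span_base)

lemma brk_in_brk_space: "x \<in> X \<Longrightarrow> y \<in> Y \<Longrightarrow> brk x y \<in> brk_space X Y"
  unfolding brk_space_def by (blast intro: span_base)

lemma mult_space_least:
  "subspace S \<Longrightarrow> (\<And>x y. x \<in> X \<Longrightarrow> y \<in> Y \<Longrightarrow> mult x y \<in> S) \<Longrightarrow> mult_space X Y \<subseteq> S"
  unfolding mult_space_def by (rule span_minimal) auto

lemma brk_space_least:
  "subspace S \<Longrightarrow> (\<And>x y. x \<in> X \<Longrightarrow> y \<in> Y \<Longrightarrow> brk x y \<in> S) \<Longrightarrow> brk_space X Y \<subseteq> S"
  unfolding brk_space_def by (rule span_minimal) auto

definition product_space :: "'a set \<Rightarrow> 'a set \<Rightarrow> 'a set" where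
  "product_space X Y = mult_space X Y + brk_space X Y"

lemma subspace_product_space: "subspace (product_space X Y)"
  by (simp add: product_space_def subspace_set_plus subspace_mult_space subspace_brk_space)

lemma mult_in_product_space: "x \<in> X \<Longrightarrow> y \<in> Y \<Longrightarrow> mult x y \<in> product_space X Y"
  and brk_in_product_space: "x \<in> X \<Longrightarrow> y \<in> Y \<Longrightarrow> brk x y \<in> product_space X Y"
  unfolding product_space_def
  using set_plus_upper[OF subspace_mult_space[of X Y] subspace_brk_space[of X Y]]
  by (auto dest: mult_in_mult_space brk_in_brk_space)

lemma product_space_least:
  assumes "subspace S"
    and "\<And>x y. x \<in> X \<Longrightarrow> y \<in> Y \<Longrightarrow> mult x y \<in> S"
    and "\<And>x y. x \<in> X \<Longrightarrow> y \<in> Y \<Longrightarrow> brk x y \<in> S"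
  shows "product_space X Y \<subseteq> S"
  unfolding product_space_def
  using assms by (intro set_plus_least mult_space_least brk_space_least)

lemma ideal_iff:
  "ideal I \<longleftrightarrow> subspace I \<and> (\<forall>x\<in>I. \<forall>p. mult x p \<in> I \<and> brk x p \<in> I)"
proof
  assume "ideal I"
  then have "subspace I" "product_space I UNIV \<subseteq> I"
    by (simp_all add: ideal_def product_space_def)
  then show "subspace I \<and> (\<forall>x\<in>I. \<forall>p. mult x p \<in> I \<and> brk x p \<in> I)"
    by (auto intro: subsetD[OF _ mult_in_product_space] subsetD[OF _ brk_in_product_space])
next
  assume "subspace I \<and> (\<forall>x\<in>I. \<forall>p. mult x p \<in> I \<and> brk x p \<in> I)"
  then show "ideal I"
    using product_space_least[of I I UNIV] by (simp add: ideal_def product_space_def)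
qed

lemma ideal_subspace: "ideal I \<Longrightarrow> subspace I"
  by (simp add: ideal_def)

lemma
  assumes "ideal I" "x \<in> I"
  shows ideal_mult_right: "mult x p \<in> I" and ideal_brk_right: "brk x p \<in> I"
    and ideal_mult_left: "mult p x \<in> I" and ideal_brk_left: "brk p x \<in> I"
proof -
  show right: "mult x p \<in> I" "brk x p \<in> I"
    using assms by (simp_all add: ideal_iff)
  show "mult p x \<in> I"
    using right(1) by (subst mult_commute)
  show "brk p x \<in> I"
    using subspace_neg[OF ideal_subspace[OF assms(1)] right(2)] by (subst brk_antisym)
qed

lemma ideal_zero: "ideal {0}"
  by (simp add: ideal_iff subspace_single_0 mult_linear_simps brk_linear_simps)

lemma ideal_set_plus:
  assumes I: "ideal I" and J: "ideal J"
  shows "ideal (I + J)"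
  unfolding ideal_iff
proof (intro conjI ballI allI)
  show "subspace (I + J)"
    using assms by (simp add: subspace_set_plus ideal_subspace)
  fix x p assume "x \<in> I + J"
  then obtain a b where x: "x = a + b" and mem: "a \<in> I" "b \<in> J" by (rule set_plus_elim)
  show "mult x p \<in> I + J"
    unfolding x mult_linear_simps
    by (intro set_plus_intro ideal_mult_right[OF I] ideal_mult_right[OF J] mem)
  show "brk x p \<in> I + J"
    unfolding x brk_linear_simps
    by (intro set_plus_intro ideal_brk_right[OF I] ideal_brk_right[OF J] mem)
qed

text \<open>
  The only case that is not immediate from the Leibniz and Jacobi rules is \<open>[x, y] \<cdot> p\<close>, where the
  Leibniz rule is used backwards: \<open>[x, y] \<cdot> p = [x, y \<cdot> p] - y \<cdot> [x, p]\<close>.  This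
  mixes the two products, so \<open>[I, J]\<close> in general only becomes an ideal after \<open>I \<cdot> J\<close> has been added.
\<close>

lemma ideal_product_space:
  assumes I: "ideal I" and J: "ideal J"
  shows "ideal (product_space I J)"
  unfolding ideal_iff
proof (intro conjI ballI allI)
  let ?P = "product_space I J"
  show P: "subspace ?P" by (rule subspace_product_space)
  fix z p assume z: "z \<in> ?P"
  have pre: "subspace {z. mult z p \<in> ?P \<and> brk z p \<in> ?P}"
    using P by (simp add: subspace_def mult_linear_simps brk_linear_simps)
  have "?P \<subseteq> {z. mult z p \<in> ?P \<and> brk z p \<in> ?P}"
  proof (rule product_space_least[OF pre])
    fix x y assume x: "x \<in> I" and y: "y \<in> J"
    have "mult (mult x y) p \<in> ?P"
      using x ideal_mult_right[OF J y] by (simp add: mult_assoc mult_in_product_space)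
    moreover have "brk (mult x y) p \<in> ?P"
      unfolding leibniz using x y ideal_brk_right[OF I x] ideal_brk_right[OF J y]
      by (intro subspace_add[OF P] mult_in_product_space)
    ultimately show "mult x y \<in> {z. mult z p \<in> ?P \<and> brk z p \<in> ?P}" by simp
    have "mult (brk x y) p = brk x (mult y p) - mult (brk x p) y"
      by (simp add: leibniz_right mult_commute[of y] mult_commute[of "brk x y"])
    also have "\<dots> \<in> ?P"
      using x y ideal_brk_right[OF I x] ideal_mult_right[OF J y]
      by (intro subspace_diff[OF P] mult_in_product_space brk_in_product_space)
    finally have "mult (brk x y) p \<in> ?P" .
    moreover have "brk (brk x y) p \<in> ?P"
      unfolding jacobi_left[of x y p] using x y ideal_brk_right[OF I x] ideal_brk_right[OF J y]
      by (intro subspace_add[OF P] brk_in_product_space)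
    ultimately show "brk x y \<in> {z. mult z p \<in> ?P \<and> brk z p \<in> ?P}" by simp
  qed
  then show "mult z p \<in> ?P" "brk z p \<in> ?P" using z by blast+
qed

lemma ideal_set_sum:
  assumes "\<And>i. i \<in> K \<Longrightarrow> ideal (X i)"
  shows "ideal (\<Sum>i\<in>K. X i)"
  using assms
proof (induction K rule: infinite_finite_induct)
  case (insert k K)
  then show ?case by (simp add: ideal_set_plus)
qed (simp_all add: set_zero ideal_zero)


section \<open>Sums of solvable ideals\<close>

lemma derived_series_Suc:
  "derived_series A (Suc n) = product_space (derived_series A n) (derived_series A n)"
  by (simp add: product_space_def)

declare derived_series.simps(2) [simp del]

lemma subspace_derived_series: "subspace A \<Longrightarrow> subspace (derived_series A n)"
  by (cases n) (simp_all add: derived_series_Suc subspace_product_space)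

lemma derived_series_mono: "A \<subseteq> B \<Longrightarrow> derived_series A n \<subseteq> derived_series B n"
proof (induction n)
  case (Suc n)
  then show ?case
    unfolding derived_series_Suc
    by (intro product_space_least subspace_product_space mult_in_product_space
        brk_in_product_space) auto
qed simp

lemma derived_series_add:
  "derived_series A (m + n) = derived_series (derived_series A m) n"
  by (induction n) (simp_all add: derived_series_Suc)

text \<open>
  Taking the derived series commutes with passing to the quotient by \<open>J\<close>: when products of sums
  are expanded, every term with a factor in the ideal \<open>J\<close> falls into \<open>J\<close>.
\<close>

lemma derived_series_set_plus:
  assumes I: "subspace I" and J: "ideal J"
  shows "derived_series (I + J) n \<subseteq> derived_series I n + J"
proof (induction n)
  case (Suc n)
  let ?D = "derived_series I n" and ?D' = "derived_series I (Suc n)"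
  have sub: "subspace (?D' + J)"
    by (simp add: subspace_set_plus subspace_derived_series I ideal_subspace[OF J])
  have J_le: "J \<subseteq> ?D' + J" and D_le: "?D' \<subseteq> ?D' + J"
    using set_plus_upper[OF subspace_derived_series[OF I] ideal_subspace[OF J]] by auto
  have main: "mult x y \<in> ?D' + J \<and> brk x y \<in> ?D' + J"
    if xy: "x \<in> derived_series (I + J) n" "y \<in> derived_series (I + J) n" for x y
  proof -
    obtain a b c d where x: "x = a + b" and y: "y = c + d" and mem: "a \<in> ?D" "b \<in> J" "c \<in> ?D" "d \<in> J"
      using subsetD[OF Suc.IH xy(1)] subsetD[OF Suc.IH xy(2)] by (auto simp: set_plus_def)
    have "mult a c \<in> ?D' + J" "brk a c \<in> ?D' + J"
      using mem D_le by (auto simp: derived_series_Suc mult_in_product_space brk_in_product_space)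
    moreover have "mult a d \<in> ?D' + J" "brk a d \<in> ?D' + J"
      "mult b y \<in> ?D' + J" "brk b y \<in> ?D' + J"
      using mem by (auto intro!: subsetD[OF J_le] intro: ideal_mult_left[OF J]
          ideal_brk_left[OF J] ideal_mult_right[OF J] ideal_brk_right[OF J])
    moreover have "mult x y = mult a c + mult a d + mult b y"
      "brk x y = brk a c + brk a d + brk b y"
      by (simp_all add: x y mult_linear_simps brk_linear_simps add.assoc)
    ultimately show ?thesis
      by (simp add: subspace_add[OF sub])
  qed
  show ?case
    unfolding derived_series_Suc[of "I + J"]
    using main by (intro product_space_least[OF sub]) auto
qed simp

lemma solvable_ideal_sum:
  assumes I: "ideal I" "solvable I" and J: "ideal J" "solvable J"
  shows "solvable (I + J)"
proof -
  obtain m n where m: "derived_series I m = {0}" and n: "derived_series J n = {0}"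
    using I(2) J(2) unfolding solvable_def by blast
  have "derived_series (I + J) m \<subseteq> {0} + J"
    using derived_series_set_plus[OF ideal_subspace[OF I(1)] J(1), of m] unfolding m .
  also have "{0} + J \<subseteq> J"
    using subspace_0[OF ideal_subspace[OF J(1)]]
    by (intro set_plus_least ideal_subspace J(1)) simp_all
  finally have "derived_series (I + J) (m + n) \<subseteq> {0}"
    unfolding derived_series_add n[symmetric] by (rule derived_series_mono)
  moreover have "0 \<in> derived_series (I + J) (m + n)"
    by (intro subspace_0 subspace_derived_series subspace_set_plus ideal_subspace I(1) J(1))
  ultimately show ?thesis
    unfolding solvable_def by blast
qed


section \<open>Nilpotency through filtrations\<close>

definition filtration :: "(nat \<Rightarrow> 'a set) \<Rightarrow> bool" where
  "filtration F \<longleftrightarrow> (\<forall>n. subspace (F n)) \<and> antimono F \<and>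
     (\<forall>i j. \<forall>x\<in>F i. \<forall>y\<in>F j. mult x y \<in> F (i + j) \<and> brk x y \<in> F (i + j))"

lemma filtrationD:
  assumes "filtration F"
  shows "subspace (F n)"
    and "i \<le> j \<Longrightarrow> F j \<subseteq> F i"
    and "x \<in> F i \<Longrightarrow> y \<in> F j \<Longrightarrow> mult x y \<in> F (i + j)"
    and "x \<in> F i \<Longrightarrow> y \<in> F j \<Longrightarrow> brk x y \<in> F (i + j)"
  using assms by (auto simp: filtration_def dest: antimonoD)

lemma poisson_power_ge_2:
  assumes "2 \<le> n"
  shows "poisson_power A n =
    (\<Sum>i = 1..<n. product_space (poisson_power A i) (poisson_power A (n - i)))"
proof -
  obtain k where "n = Suc (Suc k)"
    using assms by (metis add_2_eq_Suc le_Suc_ex)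
  then show ?thesis
    by (simp add: product_space_def atLeastLessThanSuc_atLeastAtMost del: sum.cl_ivl_Suc)
qed

declare poisson_power.simps(3) [simp del]

lemma subspace_poisson_power:
  assumes "subspace A"
  shows "subspace (poisson_power A n)"
proof (cases "2 \<le> n")
  case True
  then show ?thesis
    by (simp add: poisson_power_ge_2 subspace_set_sum subspace_product_space)
next
  case False
  then have "n = 0 \<or> n = Suc 0" by auto
  then show ?thesis using assms by auto
qed

lemma poisson_power_in_filtration:
  assumes F: "filtration F" and A: "A \<subseteq> F 1" and n: "1 \<le> n"
  shows "poisson_power A n \<subseteq> F n"
  using n
proof (induction n rule: less_induct)
  case (less n)
  show ?case
  proof (cases "n = 1")
    case False
    then have n: "2 \<le> n" using less.prems by simp
    have "product_space (poisson_power A i) (poisson_power A (n - i)) \<subseteq> F n"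
      if i: "i \<in> {1..<n}" for i
    proof -
      have le: "poisson_power A i \<subseteq> F i" "poisson_power A (n - i) \<subseteq> F (n - i)"
        using i by (auto intro!: less.IH del: subsetI)
      show ?thesis
      proof (rule product_space_least[OF filtrationD(1)[OF F]])
        fix x y assume xy: "x \<in> poisson_power A i" "y \<in> poisson_power A (n - i)"
        show "mult x y \<in> F n" "brk x y \<in> F n"
          using filtrationD(3,4)[OF F subsetD[OF le(1) xy(1)] subsetD[OF le(2) xy(2)]] i by simp_all
      qed
    qed
    then show ?thesis
      unfolding poisson_power_ge_2[OF n] by (rule set_sum_least[OF filtrationD(1)[OF F]])
  qed (use A in simp)
qed

lemma nilpotent_if_filtration:
  assumes A: "subspace A" and F: "filtration F" "A \<subseteq> F 1" "F m \<subseteq> {0}"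
  shows "nilpotent A"
proof -
  have "poisson_power A (Suc m) \<subseteq> {0}"
    using poisson_power_in_filtration[OF F(1,2), of "Suc m"] filtrationD(2)[OF F(1), of m "Suc m"] F(3)
    by auto
  moreover have "0 \<in> poisson_power A (Suc m)"
    by (intro subspace_0 subspace_poisson_power A)
  ultimately show ?thesis
    unfolding nilpotent_def by (metis One_nat_def Suc_le_mono empty_iff insert_iff le0 subset_singletonD)
qed

lemma ideal_poisson_power:
  assumes "ideal I"
  shows "ideal (poisson_power I n)"
proof (induction n rule: less_induct)
  case (less n)
  show ?case
  proof (cases "2 \<le> n")
    case True
    then show ?thesis
      unfolding poisson_power_ge_2[OF True]
      by (intro ideal_set_sum ideal_product_space less.IH) auto
  next
    case False
    then have "n = 0 \<or> n = Suc 0" by auto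
    then show ?thesis using assms by auto
  qed
qed

lemma poisson_power_product:
  assumes "subspace A" "1 \<le> i" "1 \<le> j"
  shows "product_space (poisson_power A i) (poisson_power A j) \<subseteq> poisson_power A (i + j)"
  using set_sum_upper[of "{1..<i + j}"
      "\<lambda>k. product_space (poisson_power A k) (poisson_power A (i + j - k))" i] assms
  by (simp add: poisson_power_ge_2[of "i + j"] subspace_product_space)

lemma poisson_power_Suc_subset:
  assumes I: "ideal I"
  shows "poisson_power I (Suc n) \<subseteq> poisson_power I n"
proof (induction n rule: less_induct)
  case (less n)
  note sub = ideal_subspace[OF ideal_poisson_power[OF I]]
  show ?case
  proof (cases n)
    case (Suc k)
    have "product_space (poisson_power I i) (poisson_power I (Suc n - i)) \<subseteq> poisson_power I n"
      if i: "i \<in> {1..<Suc n}" for i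
    proof -
      \<comment> \<open>One of the two factors is lowered by one degree; for \<open>n = 1\<close> both have degree 1 and
        the ideal property takes over.\<close>
      consider "n = 1" | "2 \<le> i" | "i = 1" "2 \<le> n" using i by force
      then show ?thesis
      proof cases
        case 1
        then show ?thesis
          using i I by (intro product_space_least sub) (auto simp: ideal_mult_right ideal_brk_right)
      next
        case 2
        have "poisson_power I i \<subseteq> poisson_power I (i - 1)"
          using less.IH[of "i - 1"] i 2 by auto
        then have "product_space (poisson_power I i) (poisson_power I (Suc n - i))
            \<subseteq> product_space (poisson_power I (i - 1)) (poisson_power I (Suc n - i))"
          by (intro product_space_least subspace_product_space mult_in_product_space
              brk_in_product_space) auto
        also have "\<dots> \<subseteq> poisson_power I (i - 1 + (Suc n - i))"
          using i 2 by (intro poisson_power_product ideal_subspace I) auto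
        also have "i - 1 + (Suc n - i) = n" using i by auto
        finally show ?thesis .
      next
        case 3
        have "poisson_power I n \<subseteq> poisson_power I (n - 1)"
          using less.IH[of "n - 1"] 3 by auto
        then have "product_space (poisson_power I i) (poisson_power I (Suc n - i))
            \<subseteq> product_space (poisson_power I 1) (poisson_power I (n - 1))"
          using 3 by (intro product_space_least subspace_product_space mult_in_product_space
              brk_in_product_space) auto
        also have "\<dots> \<subseteq> poisson_power I (1 + (n - 1))"
          using 3 by (intro poisson_power_product ideal_subspace I) auto
        also have "1 + (n - 1) = n" using 3 by auto
        finally show ?thesis .
      qed
    qed
    then have "(\<Sum>i = 1..<Suc n. product_space (poisson_power I i) (poisson_power I (Suc n - i)))
        \<subseteq> poisson_power I n"
      by (rule set_sum_least[OF sub])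
    then show ?thesis
      using Suc poisson_power_ge_2[of "Suc n" I] by simp
  qed simp
qed

text \<open>
  Degree 0 is filled with the whole algebra: the powers of an ideal are ideals, so the filtration
  still respects the products.  This makes mixed products of two ideals tractable.
\<close>

lemma filtration_of_nilpotent_ideal:
  assumes I: "ideal I" and nil: "nilpotent I"
  obtains F m where "filtration F" "F 0 = UNIV" "F 1 = I" "F m = {0}"
proof -
  let ?F = "\<lambda>n. if n = 0 then UNIV else poisson_power I n"
  have id: "ideal (?F n)" for n
    using ideal_poisson_power[OF I] by (simp add: ideal_iff)
  have "?F (Suc n) \<subseteq> ?F n" for n
    using poisson_power_Suc_subset[OF I] by auto
  then have anti: "antimono ?F"
    by (simp add: antimono_iff_le_Suc)
  have closed: "mult x y \<in> ?F (i + j) \<and> brk x y \<in> ?F (i + j)" if xy: "x \<in> ?F i" "y \<in> ?F j" for i j x y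
  proof (cases "i = 0 \<or> j = 0")
    case True
    then show ?thesis
      using xy ideal_mult_right[OF id] ideal_mult_left[OF id] ideal_brk_right[OF id]
        ideal_brk_left[OF id] by (metis add_0 add_0_right)
  next
    case False
    then show ?thesis
      using xy poisson_power_product[OF ideal_subspace[OF I], of i j]
        mult_in_product_space[of x "poisson_power I i" y "poisson_power I j"]
        brk_in_product_space[of x "poisson_power I i" y "poisson_power I j"] by auto
  qed
  have "filtration ?F"
    unfolding filtration_def using ideal_subspace[OF id] anti closed by blast
  moreover obtain m where "m \<ge> 1" "poisson_power I m = {0}"
    using nil by (auto simp: nilpotent_def)
  ultimately show thesis
    using that[of ?F m] by auto
qed

text \<open>
  A product with \<open>i\<close> factors from \<open>I\<close> and \<open>j\<close> factors from \<open>J\<close>, in any bracketing, lies in the \<open>i\<close>-th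
  power of \<open>I\<close> and in the \<open>j\<close>-th power of \<open>J\<close>.  So the sum of two filtrations in the sense
  \<open>G n = \<Sum>i+j=n. F i \<inter> F' j\<close> again respects the products, and reaches zero once \<open>n\<close> is so large that one
  of \<open>i\<close> and \<open>j\<close> must be large.
\<close>

lemma nilpotent_ideal_sum:
  assumes I: "ideal I" "nilpotent I" and J: "ideal J" "nilpotent J"
  shows "nilpotent (I + J)"
proof -
  obtain F m where F: "filtration F" "F 0 = UNIV" "F 1 = I" "F m = {0}"
    using filtration_of_nilpotent_ideal[OF I] .
  obtain F' m' where F': "filtration F'" "F' 0 = UNIV" "F' 1 = J" "F' m' = {0}"
    using filtration_of_nilpotent_ideal[OF J] .
  define U where "U n = (\<Union>i\<le>n. F i \<inter> F' (n - i))" for n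
  define G where "G n = span (U n)" for n
  have U_I: "x \<in> U (i + j)" if "x \<in> F i" "x \<in> F' j" for x i j
    using that by (force simp: U_def intro: bexI[of _ i])
  have U_E: "\<exists>i j. n = i + j \<and> x \<in> F i \<and> x \<in> F' j" if x: "x \<in> U n" for x n
  proof -
    obtain i where "i \<le> n" "x \<in> F i" "x \<in> F' (n - i)"
      using x by (auto simp: U_def)
    then show ?thesis
      by (intro exI[of _ i] exI[of _ "n - i"]) simp
  qed
  have "U (Suc n) \<subseteq> U n" for n
  proof
    fix x assume "x \<in> U (Suc n)"
    then obtain i j where ij: "Suc n = i + j" "x \<in> F i" "x \<in> F' j" using U_E by blast
    show "x \<in> U n"
    proof (cases j)
      case 0
      then show ?thesis
        using ij F'(2) filtrationD(2)[OF F(1), of n "Suc n"] U_I[of x n 0] by auto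
    next
      case (Suc k)
      then show ?thesis
        using ij filtrationD(2)[OF F'(1), of k "Suc k"] U_I[of x i k] by auto
    qed
  qed
  then have anti: "antimono G"
    unfolding G_def antimono_iff_le_Suc by (auto intro: span_mono[THEN subsetD])
  have closed_U: "mult x y \<in> G (a + b) \<and> brk x y \<in> G (a + b)" if xy: "x \<in> U a" "y \<in> U b" for a b x y
  proof -
    obtain i j k l where *: "a = i + j" "x \<in> F i" "x \<in> F' j" "b = k + l" "y \<in> F k" "y \<in> F' l"
      using xy U_E by meson
    have "a + b = (i + k) + (j + l)" using * by simp
    then have "mult x y \<in> U (a + b)" "brk x y \<in> U (a + b)"
      using U_I[of _ "i + k" "j + l"] * filtrationD(3,4)[OF F(1)] filtrationD(3,4)[OF F'(1)]
      by metis+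
    then show ?thesis
      unfolding G_def by (simp add: span_base)
  qed
  have sub: "subspace (G n)" for n
    by (simp add: G_def)
  have closed: "mult x y \<in> G (a + b) \<and> brk x y \<in> G (a + b)" if xy: "x \<in> G a" "y \<in> G b" for a b x y
    using bilinear_on_spans[OF mult_linear_left mult_linear_right sub, of "U a" "U b" "a + b" x y]
      bilinear_on_spans[OF brk_linear_left brk_linear_right sub, of "U a" "U b" "a + b" x y]
      closed_U xy unfolding G_def[of a] G_def[of b] by blast
  have filt: "filtration G"
    unfolding filtration_def using sub anti closed by blast
  have sum_le: "I + J \<subseteq> G 1"
  proof (rule set_plus_least[OF sub])
    show "I \<subseteq> G 1"
      using U_I[of _ 1 0] F(3) F'(2) by (auto simp: G_def intro: span_base)
    show "J \<subseteq> G 1"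
      using U_I[of _ 0 1] F'(3) F(2) by (auto simp: G_def intro: span_base)
  qed
  have zero: "G (m + m') \<subseteq> {0}"
    unfolding G_def
  proof (rule span_minimal[OF _ subspace_single_0], rule subsetI)
    fix x assume "x \<in> U (m + m')"
    then obtain i j where ij: "m + m' = i + j" "x \<in> F i" "x \<in> F' j" using U_E by blast
    then have "m \<le> i \<or> m' \<le> j" by linarith
    then show "x \<in> {0}"
      using ij F(4) F'(4) filtrationD(2)[OF F(1)] filtrationD(2)[OF F'(1)] by blast
  qed
  have "subspace (I + J)"
    by (intro subspace_set_plus ideal_subspace I(1) J(1))
  then show ?thesis
    using nilpotent_if_filtration filt sum_le zero by blast
qed


section \<open>Associative powers of a subalgebra\<close>

text \<open>
  \<open>assoc_power R n\<close> is the associative power \<open>R\<^bsup>n+1\<^esup>\<close>.  With this shift the index is the degree in which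
  \<open>R\<^bsup>n+1\<^esup>\<close> sits in the filtration below.
\<close>

fun assoc_power :: "'a set \<Rightarrow> nat \<Rightarrow> 'a set" where
  "assoc_power R 0 = R"
| "assoc_power R (Suc n) = mult_space (assoc_power R n) R"

lemma subspace_assoc_power: "subspace R \<Longrightarrow> subspace (assoc_power R n)"
  by (cases n) (simp_all add: subspace_mult_space)

lemma mult_assoc_power:
  assumes R: "subspace R" and x: "x \<in> assoc_power R i" and y: "y \<in> assoc_power R j"
  shows "mult x y \<in> assoc_power R (Suc (i + j))"
  using y
proof (induction j arbitrary: y)
  case 0
  then show ?case using x by (simp add: mult_in_mult_space)
next
  case (Suc j)
  let ?S = "{y. mult x y \<in> assoc_power R (Suc (i + Suc j))}"
  have "subspace ?S"
    using subspace_assoc_power[OF R, of "Suc (i + Suc j)"] unfolding subspace_def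
    by (simp add: mult_linear_simps del: assoc_power.simps)
  moreover have "mult z r \<in> ?S" if "z \<in> assoc_power R j" "r \<in> R" for z r
    using mult_in_mult_space[OF Suc.IH[OF that(1)] that(2)] by (simp add: mult_assoc)
  ultimately show ?case
    using mult_space_least[of ?S "assoc_power R j" R] Suc.prems by auto
qed

lemma assoc_power_subset_mult_space:
  assumes R: "subspace R"
  shows "assoc_power R (Suc (i + j)) \<subseteq> mult_space (assoc_power R i) (assoc_power R j)"
proof (induction j)
  case (Suc j)
  let ?M = "mult_space (assoc_power R i) (assoc_power R (Suc j))"
  have "mult z r \<in> ?M" if z: "z \<in> assoc_power R (Suc (i + j))" and r: "r \<in> R" for z r
  proof -
    have "subspace {z. mult z r \<in> ?M}"
      using subspace_mult_space[of "assoc_power R i" "assoc_power R (Suc j)"]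
      unfolding subspace_def
      by (simp add: mult_linear_simps)
    moreover have "mult a b \<in> {z. mult z r \<in> ?M}"
      if "a \<in> assoc_power R i" "b \<in> assoc_power R j" for a b
      using that r by (simp add: mult_assoc mult_in_mult_space)
    ultimately have "mult_space (assoc_power R i) (assoc_power R j) \<subseteq> {z. mult z r \<in> ?M}"
      by (rule mult_space_least)
    then show ?thesis using z Suc.IH by blast
  qed
  then have "mult_space (assoc_power R (Suc (i + j))) R \<subseteq> ?M"
    by (intro mult_space_least subspace_mult_space)
  then show ?case by simp
qed simp

lemma assoc_power_in_derived_series:
  assumes R: "subspace R"
  shows "assoc_power R (2 ^ n - 1) \<subseteq> derived_series R n"
proof (induction n)
  case (Suc n)
  let ?k = "2 ^ n - 1 :: nat"
  have "(2::nat) ^ Suc n - 1 = Suc (?k + ?k)"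
    using one_le_power[of "2::nat" n] unfolding power_Suc by linarith
  then have "assoc_power R (2 ^ Suc n - 1) \<subseteq> mult_space (assoc_power R ?k) (assoc_power R ?k)"
    using assoc_power_subset_mult_space[OF R, of ?k ?k] by simp
  also have "\<dots> \<subseteq> derived_series R (Suc n)"
    unfolding derived_series_Suc using Suc.IH
    by (intro mult_space_least subspace_product_space mult_in_product_space) auto
  finally show ?case .
qed simp

text \<open>
  The heart of the matter: a bracket costs only one associative factor.  By the Leibniz rule,
  \<open>[R\<^bsup>i+1\<^esup>, R\<^bsup>j+1\<^esup>]\<close> consists of sums of products of \<open>i + j + 1\<close> elements of \<open>R\<close>.
\<close>

lemma brk_assoc_power:
  assumes R: "subspace R" and closed: "\<And>x y. x \<in> R \<Longrightarrow> y \<in> R \<Longrightarrow> brk x y \<in> R"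
    and x: "x \<in> assoc_power R i" and y: "y \<in> assoc_power R j"
  shows "brk x y \<in> assoc_power R (i + j)"
proof -
  note sub = subspace_assoc_power[OF R]
  have right: "brk r y \<in> assoc_power R j" if r: "r \<in> R" and y: "y \<in> assoc_power R j" for r y j
    using y
  proof (induction j arbitrary: y)
    case 0
    then show ?case using closed r by simp
  next
    case (Suc j)
    let ?S = "{y. brk r y \<in> assoc_power R (Suc j)}"
    have "subspace ?S"
      using sub[of "Suc j"] unfolding subspace_def
      by (simp add: brk_linear_simps del: assoc_power.simps)
    moreover have "mult z s \<in> ?S" if "z \<in> assoc_power R j" "s \<in> R" for z s
    proof -
      have "mult (brk r z) s \<in> assoc_power R (Suc j)" "mult z (brk r s) \<in> assoc_power R (Suc j)"
        using that Suc.IH closed r by (simp_all add: mult_in_mult_space)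
      then show ?thesis
        unfolding mem_Collect_eq leibniz_right by (rule subspace_add[OF sub])
    qed
    ultimately show ?case
      using mult_space_least[of ?S "assoc_power R j" R] Suc.prems by auto
  qed
  show ?thesis
    using x
  proof (induction i arbitrary: x)
    case 0
    then show ?case using right y by simp
  next
    case (Suc i)
    let ?S = "{x. brk x y \<in> assoc_power R (Suc (i + j))}"
    have "subspace ?S"
      using sub[of "Suc (i + j)"] unfolding subspace_def
      by (simp add: brk_linear_simps del: assoc_power.simps)
    moreover have "mult z s \<in> ?S" if z: "z \<in> assoc_power R i" and s: "s \<in> R" for z s
    proof -
      have "mult (brk z y) s \<in> assoc_power R (Suc (i + j))"
        using Suc.IH[OF z] s by (simp add: mult_in_mult_space)
      moreover have "mult z (brk s y) \<in> assoc_power R (Suc (i + j))"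
        by (rule mult_assoc_power[OF R z right[OF s y]])
      ultimately show ?thesis
        unfolding mem_Collect_eq leibniz by (rule subspace_add[OF sub])
    qed
    ultimately show ?case
      using mult_space_least[of ?S "assoc_power R i" R] Suc.prems by auto
  qed
qed

lemma assoc_power_filtration:
  assumes R: "ideal R"
  shows "filtration (assoc_power R)"
proof -
  note sub = subspace_assoc_power[OF ideal_subspace[OF R]]
  have step: "assoc_power R (Suc n) \<subseteq> assoc_power R n" for n
  proof (induction n)
    case 0
    then show ?case
      using mult_space_least[OF ideal_subspace[OF R], of R R] ideal_mult_right[OF R] by simp
  next
    case (Suc n)
    then have "mult_space (assoc_power R (Suc n)) R \<subseteq> mult_space (assoc_power R n) R"
      by (intro mult_space_least subspace_mult_space mult_in_mult_space) auto
    then show ?case by simp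
  qed
  then have anti: "antimono (assoc_power R)"
    unfolding antimono_iff_le_Suc by blast
  have "mult x y \<in> assoc_power R (i + j)" if "x \<in> assoc_power R i" "y \<in> assoc_power R j" for x y i j
    using mult_assoc_power[OF ideal_subspace[OF R] that] step by blast
  then show ?thesis
    unfolding filtration_def
    using sub anti brk_assoc_power[OF ideal_subspace[OF R] ideal_brk_right[OF R]] by blast
qed

lemma ideal_mult_space:
  assumes R: "ideal R"
  shows "ideal (mult_space R R)"
  unfolding ideal_iff
proof (intro conjI ballI allI)
  let ?M = "mult_space R R"
  show M: "subspace ?M" by (rule subspace_mult_space)
  fix z p assume z: "z \<in> ?M"
  have pre: "subspace {z. mult z p \<in> ?M \<and> brk z p \<in> ?M}"
    using M by (simp add: subspace_def mult_linear_simps brk_linear_simps)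
  have "?M \<subseteq> {z. mult z p \<in> ?M \<and> brk z p \<in> ?M}"
  proof (rule mult_space_least[OF pre])
    fix x y assume "x \<in> R" "y \<in> R"
    then show "mult x y \<in> {z. mult z p \<in> ?M \<and> brk z p \<in> ?M}"
      using ideal_mult_right[OF R] ideal_brk_right[OF R]
      by (simp add: mult_assoc leibniz subspace_add[OF M] mult_in_mult_space)
  qed
  then show "mult z p \<in> ?M" "brk z p \<in> ?M" using z by blast+
qed

text \<open>
  \<open>R \<cdot> R\<close> is the degree 1 part of the filtration by associative powers; solvability makes that
  filtration reach zero, in degree \<open>2\<^sup>n - 1\<close> if the derived series vanishes at \<open>n\<close>.
\<close>

theorem nilpotent_square_of_solvable_ideal:
  assumes R: "ideal R" and "solvable R"
  shows "nilpotent (mult_space R R)"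
proof -
  obtain n where "derived_series R n = {0}"
    using assms by (auto simp: solvable_def)
  then have "assoc_power R (2 ^ n - 1) \<subseteq> {0}"
    using assoc_power_in_derived_series[OF ideal_subspace[OF R], of n] by simp
  then show ?thesis
    using nilpotent_if_filtration[OF subspace_mult_space assoc_power_filtration[OF R]] by simp
qed

end


section \<open>The radical and the nilradical in finite dimension\<close>

text \<open>
  A subspace of maximal dimension absorbs every other one by being summed with it.
\<close>

lemma (in finite_dimensional_vector_space) greatest_subspace_exists:
  assumes sub: "\<And>X. Q X \<Longrightarrow> subspace X" and "Q X0"
    and plus: "\<And>X Y. Q X \<Longrightarrow> Q Y \<Longrightarrow> Q (X + Y)"
  shows "Q (GREATEST X. Q X) \<and> (\<forall>Y. Q Y \<longrightarrow> Y \<subseteq> (GREATEST X. Q X))"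
proof -
  have "\<forall>X. Q X \<longrightarrow> dim X < Suc dimension"
    by (simp add: dim_subset_UNIV less_Suc_eq_le)
  then have "\<exists>M. Q M \<and> (\<forall>Y. Q Y \<longrightarrow> dim Y \<le> dim M)"
    by (rule ex_has_greatest_nat[of Q, OF \<open>Q X0\<close>])
  then obtain M where M: "Q M" "\<And>Y. Q Y \<Longrightarrow> dim Y \<le> dim M"
    by blast
  have ub: "Y \<subseteq> M" if Y: "Q Y" for Y
  proof -
    have le: "M \<subseteq> M + Y" "Y \<subseteq> M + Y"
      using subspace_0[OF sub[OF M(1)]] subspace_0[OF sub[OF Y]]
      by (force simp: set_plus_def)+
    have "M = M + Y"
      by (rule subspace_dim_equal[OF sub[OF M(1)] sub[OF plus[OF M(1) Y]] le(1)
            M(2)[OF plus[OF M(1) Y]]])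
    then show ?thesis using le(2) by simp
  qed
  then have "(GREATEST X. Q X) = M"
    using M(1) by (intro Greatest_equality)
  then show ?thesis using M(1) ub by simp
qed

theorem theorem2p5:
  fixes scale :: "'k::field \<Rightarrow> 'a::ab_group_add \<Rightarrow> 'a"
    and mult brk :: "'a \<Rightarrow> 'a \<Rightarrow> 'a"
    and Basis :: "'a set"
  assumes "poisson_algebra scale mult brk"
    and "finite_dimensional_vector_space scale Basis"
  shows "poisson_algebra.mult_space scale mult
           (poisson_algebra.radical scale mult brk) (poisson_algebra.radical scale mult brk)
         \<subseteq> poisson_algebra.nilradical scale mult brk"
proof -
  interpret poisson_algebra scale mult brk by (rule assms(1))
  interpret fd: finite_dimensional_vector_space scale Basis by (rule assms(2))
  have "solvable {0}"
    unfolding solvable_def by (rule exI[of _ 0]) simp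
  then have R: "ideal radical" "solvable radical"
    using fd.greatest_subspace_exists[of "\<lambda>I. ideal I \<and> solvable I" "{0}"]
      ideal_subspace ideal_zero ideal_set_plus solvable_ideal_sum
    unfolding radical_def by blast+
  have "nilpotent {0}"
    unfolding nilpotent_def by (rule exI[of _ 1]) simp
  then have "I \<subseteq> nilradical" if "ideal I" "nilpotent I" for I
    using fd.greatest_subspace_exists[of "\<lambda>I. ideal I \<and> nilpotent I" "{0}"] that
      ideal_subspace ideal_zero ideal_set_plus nilpotent_ideal_sum
    unfolding nilradical_def by blast
  then show ?thesis
    using ideal_mult_space[OF R(1)] nilpotent_square_of_solvable_ideal[OF R] by blast
qed

end
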